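(* Let $A\in\mathbb{R}^{m\times n}$ with $2\le m<n$ be a matrix with nonzero columns, let $b\in\mathbb{R}^m$, and let $\widetilde{\mu}(A):=\mu(A)-\mu^{(2)}(A)$. (i) Suppose $\alpha(A)<\frac{1}{\mu(A)}$. If the system $Ax=b$ has a solution $x$ obeying $$\|x\|_0<\frac12\left[1+\frac{1}{\mu(A)}+\left(\frac{1}{\mu^{(2)}(A)}-\frac{1}{\mu(A)}\right)(1-\alpha(A)\mu(A))\right],$$ then $x$ is the unique sparsest solution of the linear system. (ii) Suppose $\alpha(A)\le\frac{1}{\mu(A)}$ and $\beta(A)<\alpha(A)$. If the system $Ax=b$ has a solution $x$ obeying $$\|x\|_0<\frac12\left[1+\frac{1}{\mu(A)}+\left(\frac{1}{\mu^{(2)}(A)}-\frac{1}{\mu(A)}\right)(1-\alpha(A)\mu(A))+\frac{\alpha(A)\widetilde{\mu}(A)^2}{\mu^{(2)}(A)(1+\alpha(A)\widetilde{\mu}(A))}\right],$$ then $x$ is the unique sparsest solution of the linear system. (iii) Suppose $\mu(A)<1$ and $\alpha(A)=1$. Then a solution $x$ of $Ax=b$ obeying $$\|x\|_0<\frac12\left[1+\frac{1}{\mu(A)}+\left(\frac{1}{\mu^{(2)}(A)}-\frac{1}{\mu(A)}\right)(1-\mu(A))\right]$$ is the unique sparsest solution of the linear system.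
   Context: For a matrix $M\in\mathbb{R}^{m\times n}$ with nonzero columns $c_1,\dots,c_n$, put $g_{ij}=\frac{|c_i^Tc_j|}{\|c_i\|_2\|c_j\|_2}$. The mutual coherence is $\mu(M)=\max_{i\ne j}g_{ij}$. The sub-mutual coherence is $\mu^{(2)}(M)=\max\{g_{ij}: i\ne j,\ g_{ij}<\mu(M)\}$, the second largest distinct value among the $g_{ij}$, $i\neq j$ (convention: $0$ if this set is empty). It is known that $\mu^{(2)}(A)>0$ under the hypotheses of each of (i), (ii), (iii). For $i=1,\dots,n$ let $\alpha_i(M)=|\{j: j\ne i,\ g_{ij}=\mu(M)\}|$. The coherence rank is $\alpha(M)=\max_{1\le i\le n}\alpha_i(M)$; let $i_0$ be an index with $\alpha_{i_0}(M)=\alpha(M)$; the sub-coherence rank is $\beta(M)=\max_{i\ne i_0}\alpha_i(M)$ (independent of the choice of $i_0$). $\|x\|_0$ is the number of nonzero components of $x$. A solution $x$ of $Ax=b$ is the unique sparsest solution if $\|x\|_0<\|y\|_0$ for every solution $y\ne x$ of $Ay=b$. *)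

theory Defs
  imports "HOL-Analysis.Analysis"
begin

definition column_coherence :: "real^'n^'m \<Rightarrow> 'n \<Rightarrow> 'n \<Rightarrow> real" where
  "column_coherence M i j =
     \<bar>column i M \<bullet> column j M\<bar> / (norm (column i M) * norm (column j M))"

text \<open>The maximum is meaningful only for matrices with at least two columns.\<close>

definition mutual_coherence :: "real^'n^'m \<Rightarrow> real" where
  "mutual_coherence M = Max {column_coherence M i j | i j. i \<noteq> j}"

definition sub_mutual_coherence :: "real^'n^'m \<Rightarrow> real" where
  "sub_mutual_coherence M =
     (let S = {column_coherence M i j | i j.
                 i \<noteq> j \<and> column_coherence M i j < mutual_coherence M}
      in if S = {} then 0 else Max S)"

definition coherence_gap :: "real^'n^'m \<Rightarrow> real" where
  "coherence_gap M = mutual_coherence M - sub_mutual_coherence M"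

definition coherence_count :: "real^'n^'m \<Rightarrow> 'n \<Rightarrow> nat" where
  "coherence_count M i = card {j. j \<noteq> i \<and> column_coherence M i j = mutual_coherence M}"

definition coherence_rank :: "real^'n^'m \<Rightarrow> nat" where
  "coherence_rank M = Max (range (coherence_count M))"

text \<open>The value does not depend on which maximizing index is removed; see
  \<open>sub_coherence_rank_eq\<close> below.\<close>

definition sub_coherence_rank :: "real^'n^'m \<Rightarrow> nat" where
  "sub_coherence_rank M =
     (let i0 = (SOME i. coherence_count M i = coherence_rank M)
      in Max {coherence_count M i | i. i \<noteq> i0})"

lemma sub_coherence_rank_eq:
  fixes M :: "real^'n^'m"
  assumes i0: "coherence_count M i0 = coherence_rank M"
  shows "sub_coherence_rank M = Max {coherence_count M i | i. i \<noteq> i0}"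
proof -
  define i1 where "i1 = (SOME i. coherence_count M i = coherence_rank M)"
  have i1: "coherence_count M i1 = coherence_rank M"
    unfolding i1_def using i0 by (rule someI)
  have le: "coherence_count M i \<le> coherence_rank M" for i
    unfolding coherence_rank_def by (rule Max_ge) auto
  have eq: "Max {coherence_count M i | i. i \<noteq> a} = coherence_rank M"
    if "a \<noteq> c" "coherence_count M c = coherence_rank M" for a c
  proof (rule Max_eqI)
    show "finite {coherence_count M i | i. i \<noteq> a}" by simp
    show "coherence_rank M \<in> {coherence_count M i | i. i \<noteq> a}"
      using that by force
  qed (use le in auto)
  have "Max {coherence_count M i | i. i \<noteq> i1} = Max {coherence_count M i | i. i \<noteq> i0}"
    using eq[of i0 i1] eq[of i1 i0] i0 i1 by (cases "i0 = i1") auto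
  then show ?thesis
    unfolding sub_coherence_rank_def Let_def i1_def .
qed

definition l0norm :: "real^'n \<Rightarrow> nat" where
  "l0norm x = card {i. x $ i \<noteq> 0}"

definition unique_sparsest_solution :: "real^'n^'m \<Rightarrow> real^'m \<Rightarrow> real^'n \<Rightarrow> bool" where
  "unique_sparsest_solution A b x \<longleftrightarrow>
     A *v x = b \<and> (\<forall>y. A *v y = b \<and> y \<noteq> x \<longrightarrow> l0norm x < l0norm y)"

end

theory Submission
  imports Defs
begin

text \<open>
  If two solutions of \<open>A x = b\<close> differ by \<open>z\<close>, then \<open>l0norm z\<close> is at most the sum of their numbers of
  nonzero entries. A solution with fewer than half as many nonzero entries as every nonzero
  kernel vector is therefore the unique sparsest one (\<open>unique_sparsest_if_kernel_bound\<close>), and all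
  three parts reduce to lower bounds for \<open>l0norm z\<close> with \<open>A z = 0\<close>, \<open>z \<noteq> 0\<close>.

  Normalising the columns turns \<open>A z = 0\<close> into a statement about the weights
  \<open>u\<^sub>j = \<bar>z\<^sub>j\<bar> \<parallel>c\<^sub>j\<parallel>\<close>: each \<open>u\<^sub>i\<close> is at most the sum of the other \<open>u\<^sub>j\<close>, each multiplied by the coherence of
  columns \<open>i\<close> and \<open>j\<close> (\<open>kernel_weight_le\<close>). Among the coherences in a row at most
  \<open>\<alpha>\<close> equal \<open>\<mu>\<close>, and the others are at most \<open>\<mu>\<^sub>2\<close>, the sub-mutual coherence. So the
  \<open>l0norm z - 1\<close> coherences involved in a row add up to at most
  \<open>X = \<alpha> (\<mu> - \<mu>\<^sub>2) + (l0norm z - 1) \<mu>\<^sub>2\<close> (\<open>sum_column_coherence_le\<close>).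

  Part (i) compares the largest weight with its row: \<open>1 \<le> X\<close>. Solved for \<open>l0norm z\<close>, this is the bound,
  because \<open>1 + 1/\<mu> + (1/\<mu>\<^sub>2 - 1/\<mu>) (1 - \<alpha>\<mu>) = 1 + \<alpha> + (1 - \<alpha>\<mu>)/\<mu>\<^sub>2\<close>. Part (iii) is the case
  \<open>\<alpha> = 1\<close> of (i), where \<open>\<mu> > 0\<close> because the matrix has at least three columns
  (\<open>mutual_coherence_pos\<close>).

  In part (ii) only one row \<open>i0\<close> attains \<open>\<alpha>\<close>, and every other row sum is at most
  \<open>X - (\<mu> - \<mu>\<^sub>2)\<close>. If the largest weight is not at \<open>i0\<close>, this already gives \<open>1 + (\<mu> - \<mu>\<^sub>2) \<le> X\<close>.
  Otherwise the rows of the largest and of the second largest weight are combined. In both cases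
  \<open>1 + (\<mu> - \<mu>\<^sub>2)/(1 + \<mu>) \<le> X\<close> (\<open>kernel_bound_unique_maximal_row\<close>), which is stronger than the
  claimed bound because \<open>\<alpha> (\<mu> - \<mu>\<^sub>2) \<mu> \<le> 1\<close>.
\<close>

section \<open>Coherences of the columns\<close>

lemma column_coherence_nonneg: "0 \<le> column_coherence M i j"
  by (simp add: column_coherence_def)

lemma column_coherence_le_one: "column_coherence M i j \<le> 1"
  unfolding column_coherence_def
  by (rule divide_le_eq_1[THEN iffD2]) (use Cauchy_Schwarz_ineq2 in \<open>force simp: zero_less_mult_iff\<close>)

lemma finite_coherences: "finite {column_coherence (M::real^'n^'m) i j | i j. P i j}"
  by (rule finite_subset[of _ "range (\<lambda>(i, j). column_coherence M i j)"]) auto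

lemma column_coherence_le_mutual:
  "i \<noteq> j \<Longrightarrow> column_coherence M i j \<le> mutual_coherence M"
  unfolding mutual_coherence_def by (rule Max_ge[OF finite_coherences]) auto

lemma mutual_coherence_in:
  fixes M :: "real^'n^'m"
  assumes "2 \<le> CARD('n)"
  obtains i j where "i \<noteq> j" "mutual_coherence M = column_coherence M i j"
proof -
  obtain i j :: 'n where "i \<noteq> j"
    using assms by (metis card_2_iff' ex_card)
  then have "mutual_coherence M \<in> {column_coherence M i j | i j. i \<noteq> j}"
    unfolding mutual_coherence_def by (intro Max_in[OF finite_coherences]) auto
  then show thesis using that by blast
qed

lemma mutual_coherence_nonneg:
  fixes M :: "real^'n^'m"
  shows "2 \<le> CARD('n) \<Longrightarrow> 0 \<le> mutual_coherence M"
  by (metis column_coherence_nonneg mutual_coherence_in)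

lemma mutual_coherence_le_one:
  fixes M :: "real^'n^'m"
  shows "2 \<le> CARD('n) \<Longrightarrow> mutual_coherence M \<le> 1"
  by (metis column_coherence_le_one mutual_coherence_in)

lemma column_coherence_le_sub_mutual:
  fixes M :: "real^'n^'m"
  assumes "i \<noteq> j" "column_coherence M i j \<noteq> mutual_coherence M"
  shows "column_coherence M i j \<le> sub_mutual_coherence M"
proof -
  have "column_coherence M i j < mutual_coherence M"
    using column_coherence_le_mutual[OF assms(1)] assms(2) by (simp add: less_le)
  then have "column_coherence M i j \<in> {column_coherence M i j | i j.
      i \<noteq> j \<and> column_coherence M i j < mutual_coherence M}" (is "_ \<in> ?S")
    using assms(1) by blast
  moreover have "finite ?S" by (rule finite_coherences)
  ultimately show ?thesis
    unfolding sub_mutual_coherence_def Let_def by (auto intro: Max_ge)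
qed

lemma sub_mutual_coherence_bounds:
  fixes M :: "real^'n^'m"
  assumes "2 \<le> CARD('n)"
  shows "0 \<le> sub_mutual_coherence M" "sub_mutual_coherence M \<le> mutual_coherence M"
    and "0 < mutual_coherence M \<Longrightarrow> sub_mutual_coherence M < mutual_coherence M"
proof -
  let ?S = "{column_coherence M i j | i j.
      i \<noteq> j \<and> column_coherence M i j < mutual_coherence M}"
  have "sub_mutual_coherence M = 0
      \<or> 0 \<le> sub_mutual_coherence M \<and> sub_mutual_coherence M < mutual_coherence M"
  proof (cases "?S = {}")
    case True
    then show ?thesis unfolding sub_mutual_coherence_def Let_def by simp
  next
    case False
    have "Max ?S \<in> ?S" using finite_coherences False by (rule Max_in)
    then have "0 \<le> Max ?S \<and> Max ?S < mutual_coherence M"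
      using column_coherence_nonneg[of M] by force
    then show ?thesis
      unfolding sub_mutual_coherence_def Let_def using False by argo
  qed
  then show "0 \<le> sub_mutual_coherence M" "sub_mutual_coherence M \<le> mutual_coherence M"
    and "0 < mutual_coherence M \<Longrightarrow> sub_mutual_coherence M < mutual_coherence M"
    using mutual_coherence_nonneg[OF assms, of M] by auto
qed

lemma coherence_count_le_rank: "coherence_count M i \<le> coherence_rank M"
  unfolding coherence_rank_def by (rule Max_ge) auto

text \<open>
  Replacing the number of coherences equal to \<open>\<mu>\<close> by an upper bound \<open>k\<close> is safe because
  \<open>\<mu>\<^sub>2 \<le> \<mu>\<close>. The form linear in \<open>k\<close> stays valid when \<open>T\<close> has fewer than \<open>k\<close> elements.
\<close>

lemma sum_column_coherence_le:
  fixes M :: "real^'n^'m"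
  assumes "2 \<le> CARD('n)" "i \<notin> T" "coherence_count M i \<le> k"
  shows "(\<Sum>j\<in>T. column_coherence M i j)
    \<le> real k * coherence_gap M + real (card T) * sub_mutual_coherence M"
proof -
  let ?m = "{j\<in>T. column_coherence M i j = mutual_coherence M}"
  have "column_coherence M i j \<le> sub_mutual_coherence M
      + (if column_coherence M i j = mutual_coherence M then coherence_gap M else 0)"
    if "j \<in> T" for j
    using that assms(2) column_coherence_le_sub_mutual[of i j M]
    by (auto simp: coherence_gap_def)
  then have "(\<Sum>j\<in>T. column_coherence M i j) \<le> (\<Sum>j\<in>T. sub_mutual_coherence M
      + (if column_coherence M i j = mutual_coherence M then coherence_gap M else 0))"
    by (rule sum_mono)
  also have "\<dots> = real (card ?m) * coherence_gap M + real (card T) * sub_mutual_coherence M"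
    by (simp add: sum.distrib sum.If_cases Int_def conj_commute)
  finally have *: "(\<Sum>j\<in>T. column_coherence M i j)
    \<le> real (card ?m) * coherence_gap M + real (card T) * sub_mutual_coherence M" .
  have "card ?m \<le> coherence_count M i"
    unfolding coherence_count_def by (rule card_mono) (use assms(2) in auto)
  then have "real (card ?m) * coherence_gap M \<le> real k * coherence_gap M"
    using assms(3) sub_mutual_coherence_bounds(2)[OF assms(1), of M]
    by (intro mult_right_mono) (auto simp: coherence_gap_def)
  with * show ?thesis by linarith
qed

section \<open>Lower bounds for the sparsity of kernel vectors\<close>

text \<open>
  The factor \<open>norm (column j A)\<close> makes the weights the entries of a kernel vector of the matrix with
  normalised columns, whose Gram matrix has unit diagonal and the coherences as
  absolute values of the off-diagonal entries.
\<close>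

definition column_weight :: "real^'n^'m \<Rightarrow> real^'n \<Rightarrow> 'n \<Rightarrow> real" where
  "column_weight A z j = \<bar>z $ j\<bar> * norm (column j A)"

text \<open>Taking the inner product of \<open>A z = 0\<close> with column \<open>i\<close> expresses \<open>z\<^sub>i\<close> through the other entries.\<close>

lemma kernel_weight_le:
  fixes A :: "real^'n^'m"
  assumes nz: "\<And>i. column i A \<noteq> 0" and ker: "A *v z = 0"
  shows "column_weight A z i
    \<le> (\<Sum>j\<in>{j. z $ j \<noteq> 0} - {i}. column_coherence A i j * column_weight A z j)"
proof -
  let ?c = "\<lambda>j. column j A" and ?S = "{j. z $ j \<noteq> 0}"
  have pos: "0 < norm (?c j)" for j using nz by simp
  have "0 = ?c i \<bullet> (\<Sum>j\<in>UNIV. z $ j *\<^sub>R ?c j)"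
    using ker by (simp add: matrix_mult_sum scalar_mult_eq_scaleR)
  also have "\<dots> = (\<Sum>j\<in>UNIV. z $ j * (?c i \<bullet> ?c j))"
    by (simp add: inner_sum_right)
  also have "\<dots> = z $ i * (?c i \<bullet> ?c i) + (\<Sum>j\<in>UNIV - {i}. z $ j * (?c i \<bullet> ?c j))"
    by (rule sum.remove) auto
  also have "(\<Sum>j\<in>UNIV - {i}. z $ j * (?c i \<bullet> ?c j)) = (\<Sum>j\<in>?S - {i}. z $ j * (?c i \<bullet> ?c j))"
    by (rule sum.mono_neutral_right) auto
  finally have "\<bar>z $ i * (?c i \<bullet> ?c i)\<bar> = \<bar>\<Sum>j\<in>?S - {i}. z $ j * (?c i \<bullet> ?c j)\<bar>"
    by linarith
  also have "\<dots> \<le> (\<Sum>j\<in>?S - {i}. \<bar>z $ j * (?c i \<bullet> ?c j)\<bar>)"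
    by (rule sum_abs)
  also have "\<dots> = norm (?c i) * (\<Sum>j\<in>?S - {i}. column_coherence A i j * column_weight A z j)"
    unfolding sum_distrib_left
    by (rule sum.cong) (use nz in \<open>auto simp: column_coherence_def column_weight_def abs_mult\<close>)
  also have "\<bar>z $ i * (?c i \<bullet> ?c i)\<bar> = norm (?c i) * column_weight A z i"
    by (simp add: column_weight_def abs_mult dot_square_norm power2_eq_square)
  finally show ?thesis using pos[of i] by simp
qed

lemma card_support_remove:
  assumes "z $ i \<noteq> 0"
  shows "real (card ({j. z $ j \<noteq> 0} - {i})) = real (l0norm z) - 1"
proof -
  have "card (insert i ({j. z $ j \<noteq> 0} - {i})) = l0norm z"
    unfolding l0norm_def using assms by (intro arg_cong[where f = card]) auto
  then have "Suc (card ({j. z $ j \<noteq> 0} - {i})) = l0norm z"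
    by (subst (asm) card_insert_disjoint) auto
  then show ?thesis by linarith
qed

text \<open>
  The bound \<open>s\<close> omits the weight at \<open>i\<close> itself: at the largest weight it may be either that weight or
  only the second largest one, which is the sharper choice needed for (ii).
\<close>

lemma column_weight_le_row_sum:
  fixes A :: "real^'n^'m"
  assumes "2 \<le> CARD('n)" and "\<And>i. column i A \<noteq> 0" and "A *v z = 0"
    and i: "z $ i \<noteq> 0" and k: "coherence_count A i \<le> k"
    and s: "0 \<le> s" "\<And>j. z $ j \<noteq> 0 \<Longrightarrow> j \<noteq> i \<Longrightarrow> column_weight A z j \<le> s"
  shows "column_weight A z i
    \<le> s * (real k * coherence_gap A + (real (l0norm z) - 1) * sub_mutual_coherence A)"
proof -
  let ?T = "{j. z $ j \<noteq> 0} - {i}"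
  have "column_weight A z i \<le> (\<Sum>j\<in>?T. column_coherence A i j * column_weight A z j)"
    using assms(2,3) by (rule kernel_weight_le)
  also have "\<dots> \<le> (\<Sum>j\<in>?T. column_coherence A i j * s)"
    by (rule sum_mono) (use s column_coherence_nonneg in \<open>auto intro!: mult_left_mono\<close>)
  also have "\<dots> = s * (\<Sum>j\<in>?T. column_coherence A i j)"
    by (simp add: sum_distrib_left mult.commute)
  also have "\<dots> \<le> s * (real k * coherence_gap A + real (card ?T) * sub_mutual_coherence A)"
    by (rule mult_left_mono[OF sum_column_coherence_le[OF assms(1) _ k] s(1)]) simp
  finally show ?thesis unfolding card_support_remove[OF i] .
qed

lemma maximal_on_finite:
  fixes f :: "'a \<Rightarrow> real"
  assumes "finite S" "S \<noteq> {}"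
  obtains i where "i \<in> S" "\<And>j. j \<in> S \<Longrightarrow> f j \<le> f i"
proof -
  have "Max (f ` S) \<in> f ` S" using assms by simp
  then obtain i where "i \<in> S" "Max (f ` S) = f i" by auto
  moreover have "f j \<le> Max (f ` S)" if "j \<in> S" for j
    using that assms by simp
  ultimately show thesis using that by metis
qed

text \<open>At the index of a largest weight, the row estimate can be divided by that weight.\<close>

lemma kernel_bound_largest_weight:
  fixes A :: "real^'n^'m"
  assumes "2 \<le> CARD('n)" and nz: "\<And>i. column i A \<noteq> 0" and ker: "A *v z = 0"
    and i: "z $ i \<noteq> 0" and max: "\<And>j. z $ j \<noteq> 0 \<Longrightarrow> column_weight A z j \<le> column_weight A z i"
    and k: "coherence_count A i \<le> k"
  shows "1 \<le> real k * coherence_gap A + (real (l0norm z) - 1) * sub_mutual_coherence A"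
proof -
  have "0 < column_weight A z i"
    using i nz by (simp add: column_weight_def)
  moreover have "column_weight A z i
    \<le> column_weight A z i * (real k * coherence_gap A + (real (l0norm z) - 1) * sub_mutual_coherence A)"
    by (rule column_weight_le_row_sum[OF assms(1) nz ker i k])
      (use max calculation in auto)
  ultimately show ?thesis by simp
qed

lemma largest_weight:
  assumes "z \<noteq> 0"
  obtains i where "z $ i \<noteq> 0" "\<And>j. z $ j \<noteq> 0 \<Longrightarrow> column_weight A z j \<le> column_weight A z i"
proof -
  have "{j. z $ j \<noteq> 0} \<noteq> {}"
    using assms by (auto simp: vec_eq_iff)
  then obtain i where "i \<in> {j. z $ j \<noteq> 0}"
      "\<And>j. j \<in> {j. z $ j \<noteq> 0} \<Longrightarrow> column_weight A z j \<le> column_weight A z i"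
    using maximal_on_finite[of "{j. z $ j \<noteq> 0}" "column_weight A z"] by auto
  then show thesis using that by auto
qed

lemma kernel_bound_rank:
  fixes A :: "real^'n^'m"
  assumes "2 \<le> CARD('n)" and "\<And>i. column i A \<noteq> 0" and "A *v z = 0" and "z \<noteq> 0"
  shows "1 \<le> real (coherence_rank A) * coherence_gap A
    + (real (l0norm z) - 1) * sub_mutual_coherence A"
  using largest_weight[OF assms(4), of A] kernel_bound_largest_weight[OF assms(1-3)]
    coherence_count_le_rank by metis

text \<open>
  Suppose the largest weight \<open>a\<close> sits in the exceptional row \<open>i0\<close>, and let \<open>s\<close> be the second largest
  weight, at index \<open>j\<close>. Row \<open>i0\<close> gives \<open>a \<le> s X\<close>. In row \<open>j\<close> only the entry at \<open>i0\<close> can have a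
  weight above \<open>s\<close>; its excess \<open>a - s\<close> is multiplied by at most \<open>\<mu>\<close>, so
  \<open>s \<le> \<mu> (a - s) + s (X - (\<mu> - \<mu>\<^sub>2))\<close>. Eliminating \<open>a\<close> and dividing by \<open>s\<close> gives
  \<open>1 + \<mu> + (\<mu> - \<mu>\<^sub>2) \<le> (1 + \<mu>) X\<close>.
\<close>

lemma kernel_bound_unique_maximal_row:
  fixes A :: "real^'n^'m"
  assumes n: "2 \<le> CARD('n)" and nz: "\<And>i. column i A \<noteq> 0" and ker: "A *v z = 0" and "z \<noteq> 0"
    and lt: "sub_coherence_rank A < coherence_rank A"
  shows "1 + coherence_gap A / (1 + mutual_coherence A)
    \<le> real (coherence_rank A) * coherence_gap A + (real (l0norm z) - 1) * sub_mutual_coherence A"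
    (is "_ \<le> ?X")
proof -
  let ?u = "column_weight A z" and ?\<mu> = "mutual_coherence A" and ?d = "coherence_gap A"
  let ?S = "{j. z $ j \<noteq> 0}"
  have \<mu>: "0 \<le> ?\<mu>" and d: "0 \<le> ?d"
    using mutual_coherence_nonneg[OF n] sub_mutual_coherence_bounds[OF n, of A]
    by (auto simp: coherence_gap_def)
  have "coherence_rank A \<in> range (coherence_count A)"
    unfolding coherence_rank_def by (rule Max_in) auto
  then obtain i0 where i0: "coherence_count A i0 = coherence_rank A" by auto
  have count: "coherence_count A i \<le> coherence_rank A - 1" if "i \<noteq> i0" for i
  proof -
    have "coherence_count A i \<le> sub_coherence_rank A"
      unfolding sub_coherence_rank_eq[OF i0] by (rule Max_ge) (use that in auto)
    then show ?thesis using lt by simp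
  qed
  have X': "real (coherence_rank A - 1) * ?d
      + (real (l0norm z) - 1) * sub_mutual_coherence A = ?X - ?d"
    using lt by (simp add: of_nat_diff algebra_simps)
  obtain i where i: "z $ i \<noteq> 0" and max: "\<And>j. z $ j \<noteq> 0 \<Longrightarrow> ?u j \<le> ?u i"
    using largest_weight[OF \<open>z \<noteq> 0\<close>] by blast
  have upos: "0 < ?u j" if "z $ j \<noteq> 0" for j
    using that nz by (simp add: column_weight_def)
  show ?thesis
  proof (cases "i = i0")
    case False
    have "1 \<le> ?X - ?d"
      using kernel_bound_largest_weight[OF n nz ker i max count[OF False]] X' by simp
    moreover have "?d / (1 + ?\<mu>) \<le> ?d"
      using \<mu> d by (simp add: divide_le_eq mult_left_le algebra_simps)
    ultimately show ?thesis by linarith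
  next
    case True
    let ?T = "?S - {i0}"
    have "?T \<noteq> {}"
    proof
      assume "?T = {}"
      then show False
        using kernel_weight_le[OF nz ker, of i0] upos[of i0] i True by (simp only: sum.empty) simp
    qed
    then obtain j where j: "j \<in> ?T" and maxj: "\<And>l. l \<in> ?T \<Longrightarrow> ?u l \<le> ?u j"
      using maximal_on_finite[of ?T ?u] by auto
    have z: "z $ j \<noteq> 0" "j \<noteq> i0" "z $ i0 \<noteq> 0" and sa: "?u j \<le> ?u i0"
      using j i True max by auto
    have s: "0 < ?u j" by (rule upos[OF z(1)])
    have row_i0: "?u i0 \<le> ?u j * ?X"
      by (rule column_weight_le_row_sum[OF n nz ker z(3)]) (use s i0 maxj in auto)
    let ?R = "?S - {j}"
    have R: "i0 \<in> ?R" "finite ?R" using z by auto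
    have "?u j \<le> (\<Sum>l\<in>?R. column_coherence A j l * ?u l)"
      by (rule kernel_weight_le[OF nz ker])
    \<comment> \<open>Lower the weight at \<open>i0\<close> to \<open>s\<close>, so that all weights agree, and book the excess separately.\<close>
    also have "\<dots> \<le> (\<Sum>l\<in>?R. column_coherence A j l * ?u j
        + (if l = i0 then column_coherence A j i0 * (?u i0 - ?u j) else 0))"
    proof (rule sum_mono)
      fix l assume "l \<in> ?R"
      then show "column_coherence A j l * ?u l \<le> column_coherence A j l * ?u j
        + (if l = i0 then column_coherence A j i0 * (?u i0 - ?u j) else 0)"
        using maxj[of l] column_coherence_nonneg[of A j l]
        by (auto simp: algebra_simps intro: mult_left_mono)
    qed
    also have "\<dots> = ?u j * (\<Sum>l\<in>?R. column_coherence A j l)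
        + column_coherence A j i0 * (?u i0 - ?u j)"
      using R by (simp add: sum.distrib sum_distrib_left mult.commute)
    also have "\<dots> \<le> ?u j * (?X - ?d) + ?\<mu> * (?u i0 - ?u j)"
    proof (rule add_mono)
      have "(\<Sum>l\<in>?R. column_coherence A j l) \<le> ?X - ?d"
        using sum_column_coherence_le[OF n _ count[OF z(2)], of ?R] card_support_remove[OF z(1)] X' by simp
      then show "?u j * (\<Sum>l\<in>?R. column_coherence A j l) \<le> ?u j * (?X - ?d)"
        using s by simp
      show "column_coherence A j i0 * (?u i0 - ?u j) \<le> ?\<mu> * (?u i0 - ?u j)"
        using sa column_coherence_le_mutual[OF z(2)] by (intro mult_right_mono) auto
    qed
    also have "\<dots> \<le> ?u j * (?X - ?d) + ?\<mu> * (?u j * ?X - ?u j)"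
      using row_i0 \<mu> by (intro add_left_mono mult_left_mono) auto
    finally have "?u j * 1 \<le> ?u j * (?X - ?d + ?\<mu> * (?X - 1))"
      by (simp only: algebra_simps)
    then have "1 \<le> ?X - ?d + ?\<mu> * (?X - 1)"
      using s by (simp only: mult_le_cancel_left_pos)
    then have "?d \<le> (?X - 1) * (1 + ?\<mu>)"
      by (simp add: algebra_simps)
    then have "?d / (1 + ?\<mu>) \<le> ?X - 1"
      using \<mu> by (simp add: pos_divide_le_eq)
    then show ?thesis by linarith
  qed
qed

section \<open>From kernel vectors to sparsest solutions\<close>

lemma l0norm_diff_le: "l0norm (x - y) \<le> l0norm x + l0norm y"
proof -
  have "l0norm (x - y) \<le> card ({i. x $ i \<noteq> 0} \<union> {i. y $ i \<noteq> 0})"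
    unfolding l0norm_def by (rule card_mono) auto
  also have "\<dots> \<le> l0norm x + l0norm y"
    unfolding l0norm_def by (rule card_Un_le)
  finally show ?thesis .
qed

lemma unique_sparsest_if_kernel_bound:
  fixes A :: "real^'n^'m"
  assumes "\<And>z. A *v z = 0 \<Longrightarrow> z \<noteq> 0 \<Longrightarrow> B \<le> real (l0norm z)"
    and "A *v x = b" and "real (l0norm x) < 1/2 * B"
  shows "unique_sparsest_solution A b x"
  unfolding unique_sparsest_solution_def
proof (intro conjI allI impI)
  fix y assume y: "A *v y = b \<and> y \<noteq> x"
  then have "A *v (x - y) = 0" "x - y \<noteq> 0"
    using assms(2) by (auto simp: matrix_vector_mult_diff_distrib)
  then have "B \<le> real (l0norm (x - y))" by (rule assms(1))
  also have "\<dots> \<le> real (l0norm x) + real (l0norm y)"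
    using l0norm_diff_le[of x y] by linarith
  finally show "l0norm x < l0norm y" using assms(3) by linarith
qed (rule assms(2))

section \<open>The sparsity thresholds\<close>

text \<open>
  Here \<open>p\<close> stands for \<open>l0norm z\<close>, and \<open>e\<close> for the improvement on the bound \<open>1 \<le> X\<close>. The
  strict inequality \<open>\<alpha>\<mu> < 1 + e\<close> excludes \<open>\<mu>\<^sub>2 = 0\<close>, so division by \<open>\<mu>\<^sub>2\<close> is meaningful.
\<close>

lemma sparsity_bound_arith:
  fixes \<alpha> \<mu> \<mu>2 p e :: real
  assumes "1 + e \<le> \<alpha> * (\<mu> - \<mu>2) + (p - 1) * \<mu>2"
    and "0 < \<mu>" "0 \<le> \<mu>2" "\<alpha> * \<mu> < 1 + e"
  shows "1 + 1 / \<mu> + (1 / \<mu>2 - 1 / \<mu>) * (1 - \<alpha> * \<mu>) + e / \<mu>2 \<le> p"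
proof -
  have "\<mu>2 \<noteq> 0" using assms by auto
  then have pos: "0 < \<mu>2" using assms by auto
  have "1 + 1 / \<mu> + (1 / \<mu>2 - 1 / \<mu>) * (1 - \<alpha> * \<mu>) + e / \<mu>2
      = 1 + \<alpha> + (1 + e - \<alpha> * \<mu>) / \<mu>2"
    using pos assms(2) by (simp add: field_simps)
  also have "(1 + e - \<alpha> * \<mu>) / \<mu>2 \<le> p - 1 - \<alpha>"
    unfolding pos_divide_le_eq[OF pos] using assms(1) by (simp add: algebra_simps)
  finally show ?thesis by simp
qed

text \<open>
  The extra term of (ii) is \<open>1/\<mu>\<^sub>2\<close> times \<open>d / (1 + 1/(\<alpha> d))\<close> with \<open>d = \<mu> - \<mu>\<^sub>2\<close>; it is at most
  \<open>1/\<mu>\<^sub>2\<close> times \<open>d / (1 + \<mu>)\<close> because \<open>\<alpha> d \<mu> \<le> 1\<close>.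
\<close>

lemma improvement_arith:
  fixes \<alpha> \<mu> d :: real
  assumes "0 \<le> \<alpha>" "0 \<le> d" "d \<le> 1" "0 \<le> \<mu>" "\<alpha> * \<mu> \<le> 1"
  shows "\<alpha> * d\<^sup>2 / (1 + \<alpha> * d) \<le> d / (1 + \<mu>)"
proof -
  have "(\<alpha> * \<mu>) * d \<le> 1"
    by (rule mult_le_one[OF assms(5,2,3)])
  then have "d * (\<alpha> * d * (1 + \<mu>)) \<le> d * (1 + \<alpha> * d)"
    using assms by (intro mult_left_mono) (auto simp: algebra_simps)
  moreover have "0 < 1 + \<alpha> * d" using assms by (simp add: add_pos_nonneg)
  ultimately show ?thesis
    using assms by (simp add: divide_simps power2_eq_square algebra_simps)
qed

lemma unique_sparsest_rank:
  fixes A :: "real^'n^'m"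
  assumes n: "2 \<le> CARD('n)" and nz: "\<And>i. column i A \<noteq> 0"
    and rank: "real (coherence_rank A) < 1 / mutual_coherence A"
    and sol: "A *v x = b"
    and sparse: "real (l0norm x) < 1/2 * (1 + 1 / mutual_coherence A
            + (1 / sub_mutual_coherence A - 1 / mutual_coherence A)
              * (1 - real (coherence_rank A) * mutual_coherence A))"
  shows "unique_sparsest_solution A b x"
proof (rule unique_sparsest_if_kernel_bound[OF _ sol sparse])
  fix z assume z: "A *v z = 0" "z \<noteq> 0"
  have "0 < 1 / mutual_coherence A" using rank by (rule le_less_trans[rotated]) simp
  then have \<mu>: "0 < mutual_coherence A" by simp
  then have "real (coherence_rank A) * mutual_coherence A < 1"
    using rank by (simp add: pos_less_divide_eq)
  then show "1 + 1 / mutual_coherence A + (1 / sub_mutual_coherence A - 1 / mutual_coherence A)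
      * (1 - real (coherence_rank A) * mutual_coherence A) \<le> real (l0norm z)"
    using sparsity_bound_arith[where e = 0, OF _ \<mu> sub_mutual_coherence_bounds(1)[OF n]]
      kernel_bound_rank[OF n nz z] by (simp add: coherence_gap_def)
qed

lemma unique_sparsest_sub_rank:
  fixes A :: "real^'n^'m"
  assumes n: "2 \<le> CARD('n)" and nz: "\<And>i. column i A \<noteq> 0"
    and rank: "real (coherence_rank A) \<le> 1 / mutual_coherence A"
    and lt: "sub_coherence_rank A < coherence_rank A"
    and sol: "A *v x = b"
    and sparse: "real (l0norm x) < 1/2 * (1 + 1 / mutual_coherence A
            + (1 / sub_mutual_coherence A - 1 / mutual_coherence A)
              * (1 - real (coherence_rank A) * mutual_coherence A)
            + real (coherence_rank A) * (coherence_gap A)\<^sup>2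
              / (sub_mutual_coherence A * (1 + real (coherence_rank A) * coherence_gap A)))"
  shows "unique_sparsest_solution A b x"
proof (rule unique_sparsest_if_kernel_bound[OF _ sol sparse])
  fix z assume z: "A *v z = 0" "z \<noteq> 0"
  let ?\<alpha> = "real (coherence_rank A)" and ?d = "coherence_gap A"
  let ?\<mu> = "mutual_coherence A" and ?\<mu>2 = "sub_mutual_coherence A"
  have "0 < ?\<alpha>" using lt by simp
  then have "0 < 1 / ?\<mu>" using rank by (rule less_le_trans)
  then have \<mu>: "0 < ?\<mu>" by simp
  then have \<alpha>\<mu>: "?\<alpha> * ?\<mu> \<le> 1" using rank by (simp add: pos_le_divide_eq)
  note \<mu>2 = sub_mutual_coherence_bounds[OF n, of A]
  have d: "0 \<le> ?d" "?d \<le> 1"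
    using \<mu>2 mutual_coherence_le_one[OF n, of A] by (auto simp: coherence_gap_def)
  show "1 + 1 / ?\<mu> + (1 / ?\<mu>2 - 1 / ?\<mu>) * (1 - ?\<alpha> * ?\<mu>)
      + ?\<alpha> * ?d\<^sup>2 / (?\<mu>2 * (1 + ?\<alpha> * ?d)) \<le> real (l0norm z)"
  proof -
    let ?e = "?d / (1 + ?\<mu>)"
    have bound: "1 + ?e \<le> ?\<alpha> * (?\<mu> - ?\<mu>2) + (real (l0norm z) - 1) * ?\<mu>2"
      using kernel_bound_unique_maximal_row[OF n nz z lt] by (simp add: coherence_gap_def)
    have strict: "?\<alpha> * ?\<mu> < 1 + ?e"
    proof -
      have "0 < ?e"
        using \<mu>2(3)[OF \<mu>] \<mu> by (simp add: coherence_gap_def)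
      then show ?thesis using \<alpha>\<mu> by linarith
    qed
    have "?\<alpha> * ?d\<^sup>2 / (?\<mu>2 * (1 + ?\<alpha> * ?d)) = (?\<alpha> * ?d\<^sup>2 / (1 + ?\<alpha> * ?d)) / ?\<mu>2"
      by simp
    also have "\<dots> \<le> ?e / ?\<mu>2"
      using improvement_arith[of ?\<alpha> ?d ?\<mu>] d \<mu> \<alpha>\<mu> \<mu>2 by (intro divide_right_mono) auto
    finally show ?thesis
      using sparsity_bound_arith[OF bound \<mu> \<mu>2(1) strict] by linarith
  qed
qed

text \<open>
  If \<open>\<mu> = 0\<close>, every off-diagonal coherence equals \<open>\<mu>\<close>, so every row counts \<open>n - 1 \<ge> 2\<close> of
  them, against \<open>\<alpha> = 1\<close>.
\<close>

lemma mutual_coherence_pos: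
  fixes A :: "real^'n^'m"
  assumes n: "3 \<le> CARD('n)" and "coherence_rank A = 1"
  shows "0 < mutual_coherence A"
proof (rule ccontr)
  assume "\<not> 0 < mutual_coherence A"
  then have \<mu>: "mutual_coherence A = 0"
    using mutual_coherence_nonneg[of A] n by simp
  fix i :: 'n
  have "column_coherence A i j = 0" if "j \<noteq> i" for j
    using column_coherence_le_mutual[of i j A] column_coherence_nonneg[of A i j] that \<mu> by simp
  then have "coherence_count A i = card (UNIV - {i})"
    unfolding coherence_count_def using \<mu> by (intro arg_cong[where f = card]) auto
  also have "\<dots> = CARD('n) - 1" by (simp add: card_Diff_singleton)
  finally show False
    using coherence_count_le_rank[of A i] assms by simp
qed

theorem theorem2p10:
  fixes A :: "real^'n^'m" and b :: "real^'m"
  assumes "2 \<le> CARD('m)" and "CARD('m) < CARD('n)"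
    and "\<And>i. column i A \<noteq> 0"
  shows
    "(real (coherence_rank A) < 1 / mutual_coherence A \<longrightarrow>
       (\<forall>x. A *v x = b \<and>
          real (l0norm x) < 1/2 * (1 + 1 / mutual_coherence A
            + (1 / sub_mutual_coherence A - 1 / mutual_coherence A)
              * (1 - real (coherence_rank A) * mutual_coherence A))
          \<longrightarrow> unique_sparsest_solution A b x))
     \<and>
     (real (coherence_rank A) \<le> 1 / mutual_coherence A \<and>
      sub_coherence_rank A < coherence_rank A \<longrightarrow>
       (\<forall>x. A *v x = b \<and>
          real (l0norm x) < 1/2 * (1 + 1 / mutual_coherence A
            + (1 / sub_mutual_coherence A - 1 / mutual_coherence A)
              * (1 - real (coherence_rank A) * mutual_coherence A)
            + real (coherence_rank A) * (coherence_gap A)\<^sup>2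
              / (sub_mutual_coherence A * (1 + real (coherence_rank A) * coherence_gap A)))
          \<longrightarrow> unique_sparsest_solution A b x))
     \<and>
     (mutual_coherence A < 1 \<and> coherence_rank A = 1 \<longrightarrow>
       (\<forall>x. A *v x = b \<and>
          real (l0norm x) < 1/2 * (1 + 1 / mutual_coherence A
            + (1 / sub_mutual_coherence A - 1 / mutual_coherence A)
              * (1 - mutual_coherence A))
          \<longrightarrow> unique_sparsest_solution A b x))"
proof -
  have n: "2 \<le> CARD('n)" "3 \<le> CARD('n)" using assms(1,2) by auto
  have iii: "real (coherence_rank A) < 1 / mutual_coherence A"
    if "mutual_coherence A < 1" "coherence_rank A = 1"
    using that mutual_coherence_pos[OF n(2) that(2)] by (simp add: less_divide_eq)
  show ?thesis
    using unique_sparsest_rank[OF n(1) assms(3)]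
      unique_sparsest_sub_rank[OF n(1) assms(3)] iii
    by (intro conjI allI impI) auto
qed

end
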